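(* Let $f:B(0,r)\to\mathbb{R}$ satisfy Assumption A (stated in the context). (1) There exist a constant $C_1>0$ and $\lambda_1\in\mathbb{N}$ such that for all integers $\lambda\ge\lambda_1$, $$\mathbb{E}_{X_1,\dots,X_\lambda\sim U(B(0,r))}\left[f(X_{(1)})\right]\ge C_1\,\lambda^{-2/d}.$$ (2) Let $(\mu_\lambda)_{\lambda\in\mathbb{N}}$ be a sequence of integers such that $1\le\mu_\lambda\le\lambda-1$ for all $\lambda\ge2$ and $\mu_\lambda\to\infty$ as $\lambda\to\infty$. Then there exist a constant $C_2>0$ and $\lambda_2\in\mathbb{N}$ such that for all $h\in[0,\max f]$ and all integers $\lambda\ge\lambda_2$, $$\mathbb{E}_{X_1,\dots,X_\lambda\sim U(B(0,r))}\left[f(X_{(1)})\mid f(X_{(\mu_\lambda+1)})=h\right]\ge C_2\,h\,\mu_\lambda^{-2/d}.$$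
   Context: Here $d\ge1$ is an integer, $r>0$, $\|\cdot\|$ is the Euclidean norm on $\mathbb{R}^d$, $B(0,r)$ is the closed Euclidean ball of radius $r$ centered at $0$, and $U(S)$ is the uniform distribution on $S$. Assumption A: $f:B(0,r)\to\mathbb{R}$ is continuous and admits a unique optimum point (global minimizer) $x^\star$, with $\|x^\star\|<r$ and $f(x^\star)=0$. Moreover there are a symmetric positive definite matrix $\mathbf{H}$, a real number $\alpha>2$ and a bounded function $\varepsilon$ (there is $M>0$ with $|\varepsilon|\le M$ everywhere) such that for all $x\in B(0,r)$, $$f(x)=\|x-x^\star\|_{\mathbf{H}}^2+\|x-x^\star\|_{\mathbf{H}}^{\alpha}\,\varepsilon(x-x^\star),\qquad \|y\|_{\mathbf{H}}:=\sqrt{y^T\mathbf{H}y}.$$ Sampling: $X_1,\dots,X_\lambda$ are i.i.d. with law $U(B(0,r))$; $X_{(1)},\dots,X_{(\lambda)}$ denote the same points reordered so that $f(X_{(1)})\le\dots\le f(X_{(\lambda)})$. For random variables $Z,Y$, $h\mapsto\mathbb{E}[Z\mid Y=h]$ denotes a version of the Borel function $\psi$ with $\psi(Y)=\mathbb{E}[Z\mid Y]$ almost surely; an inequality "for all $h$" involving it means that it holds for a suitable version, i.e. for almost every $h$ with respect to the law of $Y$. *)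

theory Defs
  imports "HOL-Probability.Probability"
begin

definition sym_pos_def :: "real^'n^'n \<Rightarrow> bool" where
  "sym_pos_def H \<longleftrightarrow> transpose H = H \<and> (\<forall>y. y \<noteq> 0 \<longrightarrow> 0 < y \<bullet> (H *v y))"

definition mat_norm :: "real^'n^'n \<Rightarrow> real^'n \<Rightarrow> real" where
  "mat_norm H y = sqrt (y \<bullet> (H *v y))"

text \<open>The objective is only meaningful on the closed ball; as a total function its values
  outside \<^term>\<open>cball 0 r\<close> are unconstrained, and nothing below depends on them.\<close>

definition assumption_A :: "real \<Rightarrow> (real^'n \<Rightarrow> real) \<Rightarrow> bool" where
  "assumption_A r f \<longleftrightarrow>
     continuous_on (cball 0 r) f \<and>
     (\<exists>xstar.
        (\<forall>x. is_arg_min f (\<lambda>y. y \<in> cball 0 r) x \<longleftrightarrow> x = xstar) \<and>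
        norm xstar < r \<and> f xstar = 0 \<and>
        (\<exists>H \<alpha> \<epsilon> M. sym_pos_def H \<and> \<alpha> > 2 \<and> M > 0 \<and> (\<forall>y. \<bar>\<epsilon> y\<bar> \<le> M) \<and>
           (\<forall>x\<in>cball 0 r.
              f x = (mat_norm H (x - xstar))\<^sup>2 + mat_norm H (x - xstar) powr \<alpha> * \<epsilon> (x - xstar))))"

text \<open>The sample points take values in the ball surely, not just almost surely: \<open>f\<close> need not be
  measurable off the ball, and a non-measurable integrand would have Bochner integral \<open>0\<close>.\<close>

definition iid_uniform_ball :: "'a measure \<Rightarrow> real \<Rightarrow> nat \<Rightarrow> (nat \<Rightarrow> 'a \<Rightarrow> real^'n) \<Rightarrow> bool" where
  "iid_uniform_ball M r n X \<longleftrightarrow>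
     prob_space M \<and>
     prob_space.indep_vars M (\<lambda>_. borel) X {1..n} \<and>
     (\<forall>i\<in>{1..n}. X i \<in> space M \<rightarrow> cball 0 r \<and>
        distr M borel (X i) = uniform_measure lborel (cball 0 r))"

text \<open>\<open>ranked f n x k\<close> is the \<open>k\<close>-th point (\<open>1 \<le> k \<le> n\<close>) of \<open>x 1, \<dots>, x n\<close> reordered by increasing
  \<open>f\<close>-value. Ties are broken by index, which does not affect the value of \<open>f\<close> at that point.\<close>

definition ranked :: "('b \<Rightarrow> real) \<Rightarrow> nat \<Rightarrow> (nat \<Rightarrow> 'b) \<Rightarrow> nat \<Rightarrow> 'b" where
  "ranked f n x k = sort_key f (map x [1..<Suc n]) ! (k - 1)"

text \<open>\<open>\<psi>\<close> is a version of \<open>h \<mapsto> E[Z | Y = h]\<close>.\<close>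

definition cond_exp_version ::
  "'a measure \<Rightarrow> ('a \<Rightarrow> real) \<Rightarrow> ('a \<Rightarrow> real) \<Rightarrow> (real \<Rightarrow> real) \<Rightarrow> bool" where
  "cond_exp_version M Z Y \<psi> \<longleftrightarrow>
     \<psi> \<in> borel_measurable borel \<and>
     (AE \<omega> in M. \<psi> (Y \<omega>) = real_cond_exp M (vimage_algebra (space M) Y borel) Z \<omega>)"

end

theory Submission
  imports Defs
begin

text \<open>
  On the ball, \<open>f x\<close> lies between two positive multiples of \<open>\<parallel>x - xstar\<parallel>\<^sup>2\<close>, so the distribution
  function of \<open>Y\<^sub>i = f (X\<^sub>i)\<close> is of exact order \<open>t\<^bsup>d/2\<^esup>\<close>. Part (1) is then a union bound: with
  \<open>t\<close> of order \<open>\<lambda>\<^bsup>-2/d\<^esup>\<close>, each \<open>Y\<^sub>i\<close> is below \<open>t\<close> with probability at most \<open>1/(2\<lambda>)\<close>.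

  Part (2) is the same union bound given the \<open>(\<mu>+1)\<close>-st value. Level sets of \<open>f\<close> may have positive
  measure, so ties are broken by index. For \<open>s\<close> of order \<open>\<mu>\<^bsup>-2/d\<^esup>\<close> one has
  \<open>P(Y\<^sub>i < s h) \<le> P(Y\<^sub>i < h) / (2\<mu>)\<close> for all \<open>h \<le> max f\<close>. Integrating out \<open>Y\<^sub>i\<close> alone, for fixed \<open>j\<close> of
  rank \<open>\<mu>\<close> and fixed \<open>i\<close> preceding \<open>j\<close>, and summing over the \<open>\<mu>\<close> such \<open>i\<close> shows that the minimum is
  below \<open>s\<close> times the \<open>(\<mu>+1)\<close>-st value with conditional probability at most \<open>1/2\<close>.
\<close>

section \<open>Factorization through a generating map\<close>

text \<open>The Doob-Dynkin lemma. Level sets of the approximating simple functions are preimages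
  under \<open>Y\<close>, so these functions factor through \<open>Y\<close>, and so does their
  limit. It turns \<open>real_cond_exp\<close>, a function on the sample space, into a Borel
  function of the conditioning value.\<close>

lemma vimage_algebra_factorization:
  fixes \<phi> :: "'a \<Rightarrow> real"
  assumes meas: "\<phi> \<in> borel_measurable (vimage_algebra X Y N)" and Y: "Y \<in> X \<rightarrow> space N"
  shows "\<exists>\<psi>\<in>borel_measurable N. \<forall>x\<in>X. \<phi> x = \<psi> (Y x)"
proof -
  let ?F = "vimage_algebra X Y N"
  from borel_measurable_implies_sequence_metric[OF meas, of 0]
  obtain s where s: "\<And>i. simple_function ?F (s i)" 
    and lim: "\<And>x. x \<in> X \<Longrightarrow> (\<lambda>i. s i x) \<longlonglongrightarrow> \<phi> x"
    by (auto)
  have "\<exists>\<psi>\<in>borel_measurable N. \<forall>x\<in>X. s i x = \<psi> (Y x)" for i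
  proof -
    have "\<exists>A. A \<in> sets N \<and> s i -` {v} \<inter> X = Y -` A \<inter> X" for v
      using simple_functionD(2)[OF s[of i], of "{v}"] sets_vimage_algebra2[OF Y] by auto
    then obtain A where A: "\<And>v. A v \<in> sets N" "\<And>v. s i -` {v} \<inter> X = Y -` A v \<inter> X"
      by metis
    have fin: "finite (s i ` X)"
      using simple_functionD(1)[OF s[of i]] by simp
    define \<psi> where "\<psi> y = (\<Sum>v\<in>s i ` X. indicator (A v) y * v)" for y
    have "\<psi> \<in> borel_measurable N"
      unfolding \<psi>_def using A(1) by measurable
    moreover have "s i x = \<psi> (Y x)" if x: "x \<in> X" for x
    proof -
      have "indicator (A v) (Y x) = (if v = s i x then 1 else (0::real))" for v
        using A(2)[of v] x by (auto simp: indicator_def)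
      then show ?thesis
        using fin x by (simp add: \<psi>_def if_distrib[of "\<lambda>c. c * _"] cong: if_cong)
    qed
    ultimately show ?thesis by blast
  qed
  then obtain \<psi> where \<psi>: "\<And>i. \<psi> i \<in> borel_measurable N" "\<And>i x. x \<in> X \<Longrightarrow> s i x = \<psi> i (Y x)"
    by metis
  \<comment> \<open>The factors may diverge off the image of \<open>Y\<close>; the total function
    \<open>lim\<close> is measurable all the same and has the right value on that image.\<close>
  have "(\<lambda>y. lim (\<lambda>i. \<psi> i y)) \<in> borel_measurable N"
    using \<psi>(1) by measurable
  moreover have "\<forall>x\<in>X. \<phi> x = lim (\<lambda>i. \<psi> i (Y x))"
    using limI[OF lim] \<psi>(2) by simp
  ultimately show ?thesis
    by (intro bexI[of _ "\<lambda>y. lim (\<lambda>i. \<psi> i y)"])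
qed

section \<open>Order statistics\<close>

text \<open>If \<open>ys ! k\<close> were below \<open>v\<close>, the entries \<open>0..k\<close>
  would be too many for the first count; if it were above, at most \<open>k\<close> entries could be
  \<open>\<le> v\<close>. Both counts are invariant under permutation, so they can be evaluated on
  the unsorted sample.\<close>

lemma sorted_nth_eqI:
  fixes ys :: "'b::linorder list"
  assumes "sorted ys" and k: "k < length ys"
    and less: "length (filter (\<lambda>y. y < v) ys) \<le> k" and le: "k < length (filter (\<lambda>y. y \<le> v) ys)"
  shows "ys ! k = v"
proof (rule ccontr)
  assume "ys ! k \<noteq> v"
  then consider "ys ! k < v" | "v < ys ! k" by fastforce
  then show False
  proof cases
    case 1
    then have "{..k} \<subseteq> {i. i < length ys \<and> ys ! i < v}"
      using assms(1) k by (auto dest: sorted_nth_mono intro: le_less_trans)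
    from card_mono[OF _ this] less show False
      by (simp add: length_filter_conv_card)
  next
    case 2
    have "{i. i < length ys \<and> ys ! i \<le> v} \<subseteq> {..<k}"
    proof
      fix i assume i: "i \<in> {i. i < length ys \<and> ys ! i \<le> v}"
      show "i \<in> {..<k}"
      proof (rule ccontr)
        assume "i \<notin> {..<k}"
        with i assms(1) have "ys ! k \<le> ys ! i" by (auto intro: sorted_nth_mono)
        with i 2 show False by auto
      qed
    qed
    from card_mono[OF _ this] le show False
      by (simp add: length_filter_conv_card)
  qed
qed

section \<open>Ranks of indices in the presence of ties\<close>

definition precedes :: "(nat \<Rightarrow> real) \<Rightarrow> nat \<Rightarrow> nat \<Rightarrow> bool" where
  "precedes y i j \<longleftrightarrow> y i < y j \<or> (y i = y j \<and> i < j)"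

text \<open>Ranks start at \<open>0\<close>, whereas the positions in \<^const>\<open>ranked\<close> start at \<open>1\<close>.\<close>

definition rank_in :: "nat \<Rightarrow> (nat \<Rightarrow> real) \<Rightarrow> nat \<Rightarrow> nat" where
  "rank_in n y j = card {i\<in>{1..n}. precedes y i j}"

text \<open>\<open>precedes\<close> is a strict total order on indices even when values coincide,
  and \<open>rank_in\<close> is strictly increasing along it; an injection of \<open>{1..n}\<close>
  into \<open>{..<n}\<close> is onto. Hence the events that \<open>j\<close> has rank
  \<open>k\<close> partition the sample space.\<close>

lemma ex1_rank_in:
  assumes "k < n"
  shows "\<exists>!j. j \<in> {1..n} \<and> rank_in n y j = k"
proof -
  have mono: "rank_in n y i < rank_in n y j" if "precedes y i j" "i \<in> {1..n}" "j \<in> {1..n}" for i j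
    unfolding rank_in_def
    by (rule psubset_card_mono) (use that in \<open>auto simp: precedes_def\<close>)
  have inj: "inj_on (rank_in n y) {1..n}"
  proof (rule inj_onI)
    fix i j assume ij: "i \<in> {1..n}" "j \<in> {1..n}" "rank_in n y i = rank_in n y j"
    show "i = j"
    proof (rule ccontr)
      assume "i \<noteq> j"
      then have "precedes y i j \<or> precedes y j i" by (auto simp: precedes_def)
      with ij mono[of i j] mono[of j i] show False by auto
    qed
  qed
  have "rank_in n y j < n" if "j \<in> {1..n}" for j
  proof -
    have "j \<notin> {i\<in>{1..n}. precedes y i j}" by (simp add: precedes_def)
    with that have "{i\<in>{1..n}. precedes y i j} \<subset> {1..n}" by blast
    then have "rank_in n y j < card {1..n}"
      unfolding rank_in_def by (rule psubset_card_mono[OF finite_atLeastAtMost])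
    then show ?thesis by simp
  qed
  then have "rank_in n y ` {1..n} \<subseteq> {..<n}" by auto
  then have "rank_in n y ` {1..n} = {..<n}"
    by (intro card_subset_eq) (simp_all only: card_image[OF inj] finite_lessThan card_lessThan, simp)
  with assms have "k \<in> rank_in n y ` {1..n}" by simp
  then obtain j where "j \<in> {1..n}" "rank_in n y j = k" by auto
  with inj show ?thesis by (metis inj_onD)
qed

lemma length_filter_sort_key:
  "length (filter P (map f (sort_key f xs))) = length (filter P (map f xs))"
proof -
  have "mset (filter P (map f (sort_key f xs))) = mset (filter P (map f xs))"
    by simp
  then show ?thesis by (metis size_mset)
qed

lemma length_filter_upt:
  "length (filter P (map y [1..<Suc n])) = card {i\<in>{1..n}. P (y i)}"
proof -
  have "length (filter P (map y [1..<Suc n])) = length (filter (P \<circ> y) [1..<Suc n])"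
    by (simp add: filter_map)
  also have "\<dots> = card (set (filter (P \<circ> y) [1..<Suc n]))"
    by (intro distinct_card[symmetric] distinct_filter distinct_upt)
  also have "set (filter (P \<circ> y) [1..<Suc n]) = {i\<in>{1..n}. P (y i)}"
    by auto
  finally show ?thesis .
qed

text \<open>Indices with smaller value precede \<open>j\<close>, so at most \<open>k\<close> values
  are smaller; the \<open>k\<close> predecessors together with \<open>j\<close> make more than
  \<open>k\<close> values that are no larger. This bridges the sorting in \<open>ranked\<close> and
  the counting in \<open>rank_in\<close>.\<close>

lemma ranked_eqI:
  assumes j: "j \<in> {1..n}" and rank: "rank_in n (\<lambda>i. f (x i)) j = k"
  shows "f (ranked f n x (Suc k)) = f (x j)"
proof -
  let ?y = "\<lambda>i. f (x i)" and ?xs = "map x [1..<Suc n]"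
  let ?ys = "map f (sort_key f ?xs)"
  have eq: "length (filter P ?ys) = card {i\<in>{1..n}. P (?y i)}" for P
    unfolding length_filter_sort_key using length_filter_upt[of P ?y n] by (simp add: comp_def del: upt_Suc)
  have len: "length ?ys = n" by simp
  have "card {i\<in>{1..n}. ?y i < ?y j} \<le> k"
    unfolding rank[symmetric] rank_in_def by (rule card_mono) (auto simp: precedes_def)
  moreover have k: "k < card {i\<in>{1..n}. ?y i \<le> ?y j}"
    unfolding rank[symmetric] rank_in_def
    by (rule psubset_card_mono) (use j in \<open>auto simp: precedes_def\<close>)
  moreover have le: "card {i\<in>{1..n}. ?y i \<le> ?y j} \<le> card {1..n}"
    by (rule card_mono) auto
  ultimately have "?ys ! k = ?y j"
    by (intro sorted_nth_eqI) (simp_all only: eq len card_atLeastAtMost sorted_sort_key)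
  moreover have "k < length (sort_key f ?xs)" using k le by simp
  ultimately show ?thesis
    by (simp add: ranked_def del: upt_Suc)
qed

lemma ranked_mem:
  assumes "k < n"
  shows "\<exists>i\<in>{1..n}. ranked f n x (Suc k) = x i"
proof -
  have "ranked f n x (Suc k) \<in> set (sort_key f (map x [1..<Suc n]))"
    unfolding ranked_def using assms by (intro nth_mem) simp
  then show ?thesis by auto
qed

lemma measurable_precedes_card:
  assumes "j \<in> I'" "I \<subseteq> I'"
    and y: "\<And>k. k \<in> I' \<Longrightarrow> (\<lambda>\<omega>. y \<omega> k) \<in> borel_measurable N"
  shows "(\<lambda>\<omega>. card {k\<in>I. precedes (y \<omega>) k j}) \<in> measurable N (count_space UNIV)"
proof (rule measurable_card)
  fix i
  show "{\<omega>\<in>space N. i \<in> {k\<in>I. precedes (y \<omega>) k j}} \<in> sets N"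
  proof (cases "i \<in> I")
    case True
    then have [measurable]: "(\<lambda>\<omega>. y \<omega> i) \<in> borel_measurable N" "(\<lambda>\<omega>. y \<omega> j) \<in> borel_measurable N"
      using assms by auto
    have "Measurable.pred N (\<lambda>\<omega>. y \<omega> i < y \<omega> j \<or> y \<omega> i = y \<omega> j \<and> i < j)" by measurable
    with True show ?thesis by (simp add: precedes_def pred_def)
  qed simp
qed

text \<open>The order statistic is rewritten as a sum over \<open>j\<close> with a single surviving
  term, picked out by the measurable event that \<open>j\<close> has rank \<open>k\<close>.\<close>

lemma measurable_ranked:
  assumes y: "\<And>i. i \<in> {1..n} \<Longrightarrow> (\<lambda>\<omega>. f (x i \<omega>)) \<in> borel_measurable M" and k: "k < n"
  shows "(\<lambda>\<omega>. f (ranked f n (\<lambda>i. x i \<omega>) (Suc k))) \<in> borel_measurable M"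
proof -
  let ?R = "\<lambda>j \<omega>. rank_in n (\<lambda>i. f (x i \<omega>)) j = k"
  have eq: "f (ranked f n (\<lambda>i. x i \<omega>) (Suc k)) = (\<Sum>j\<in>{1..n}. if ?R j \<omega> then f (x j \<omega>) else 0)" for \<omega>
  proof -
    from ex1_rank_in[OF k, of "\<lambda>i. f (x i \<omega>)"] obtain j where
      j: "j \<in> {1..n}" "?R j \<omega>" and u: "\<And>i. i \<in> {1..n} \<Longrightarrow> ?R i \<omega> \<Longrightarrow> i = j" by blast
    have "(\<Sum>i\<in>{1..n}. if ?R i \<omega> then f (x i \<omega>) else 0) = (\<Sum>i\<in>{1..n}. if i = j then f (x j \<omega>) else 0)"
      by (rule sum.cong[OF refl]) (use j u in metis)
    also have "\<dots> = f (x j \<omega>)" using j(1) by simp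
    finally show ?thesis using ranked_eqI[of j n f "\<lambda>i. x i \<omega>", OF j] by simp
  qed
  have R: "Measurable.pred M (?R j)" if j: "j \<in> {1..n}" for j
  proof -
    have [measurable]: "(\<lambda>\<omega>. rank_in n (\<lambda>i. f (x i \<omega>)) j) \<in> measurable M (count_space UNIV)"
      unfolding rank_in_def using j y by (intro measurable_precedes_card[of _ "{1..n}"]) auto
    show ?thesis by measurable
  qed
  show ?thesis
    unfolding eq using y R by (intro borel_measurable_sum measurable_If) auto
qed

section \<open>The minimum given a higher order statistic\<close>

text \<open>Independence makes the joint law a product, so by Tonelli \<open>A\<close> may be frozen
  while \<open>B\<close> is averaged over a fresh \<open>\<omega>'\<close>.\<close>

lemma (in prob_space) indep_var_nn_integral_mono:
  assumes ind: "indep_var S A T B"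
    and [measurable]: "\<Phi> \<in> borel_measurable (S \<Otimes>\<^sub>M T)" "\<Psi> \<in> borel_measurable (S \<Otimes>\<^sub>M T)"
    and le: "\<And>\<omega>. \<omega> \<in> space M \<Longrightarrow>
      (\<integral>\<^sup>+\<omega>'. \<Phi> (A \<omega>, B \<omega>') \<partial>M) \<le> (\<integral>\<^sup>+\<omega>'. \<Psi> (A \<omega>, B \<omega>') \<partial>M)"
  shows "(\<integral>\<^sup>+\<omega>. \<Phi> (A \<omega>, B \<omega>) \<partial>M) \<le> (\<integral>\<^sup>+\<omega>. \<Psi> (A \<omega>, B \<omega>) \<partial>M)"
proof -
  have A[measurable]: "A \<in> measurable M S" and B[measurable]: "B \<in> measurable M T"
    and prod: "distr M S A \<Otimes>\<^sub>M distr M T B = distr M (S \<Otimes>\<^sub>M T) (\<lambda>x. (A x, B x))"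
    using ind unfolding indep_var_distribution_eq by auto
  interpret DB: prob_space "distr M T B" by (rule prob_space_distr) fact
  have fubini: "(\<integral>\<^sup>+\<omega>. F (A \<omega>, B \<omega>) \<partial>M) = (\<integral>\<^sup>+\<omega>. (\<integral>\<^sup>+\<omega>'. F (A \<omega>, B \<omega>') \<partial>M) \<partial>M)"
    if F[measurable]: "F \<in> borel_measurable (S \<Otimes>\<^sub>M T)" for F :: "_ \<Rightarrow> ennreal"
  proof -
    have "(\<integral>\<^sup>+\<omega>. F (A \<omega>, B \<omega>) \<partial>M) = (\<integral>\<^sup>+z. F z \<partial>(distr M S A \<Otimes>\<^sub>M distr M T B))"
      unfolding prod by (subst nn_integral_distr) auto
    also have "\<dots> = (\<integral>\<^sup>+a. (\<integral>\<^sup>+b. F (a, b) \<partial>distr M T B) \<partial>distr M S A)"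
      by (subst DB.nn_integral_fst) auto
    also have "\<dots> = (\<integral>\<^sup>+\<omega>. (\<integral>\<^sup>+b. F (A \<omega>, b) \<partial>distr M T B) \<partial>M)"
      by (subst nn_integral_distr) auto
    also have "\<dots> = (\<integral>\<^sup>+\<omega>. (\<integral>\<^sup>+\<omega>'. F (A \<omega>, B \<omega>') \<partial>M) \<partial>M)"
    proof (rule nn_integral_cong)
      fix \<omega> assume "\<omega> \<in> space M"
      then have [measurable]: "A \<omega> \<in> space S" using A by (rule measurable_space[rotated])
      show "(\<integral>\<^sup>+b. F (A \<omega>, b) \<partial>distr M T B) = (\<integral>\<^sup>+\<omega>'. F (A \<omega>, B \<omega>') \<partial>M)"
        by (subst nn_integral_distr) auto
    qed
    finally show ?thesis .
  qed
  show ?thesis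
    unfolding fubini[OF assms(2)] fubini[OF assms(3)] by (intro nn_integral_mono le)
qed

text \<open>All variables but \<open>Y i\<close> are frozen. The threshold \<open>Y j\<close> is
  then a constant, and \<open>tail\<close> trades the event below \<open>s * Y j\<close> for
  \<open>p\<close> times the event below \<open>Y j\<close>. The weight \<open>g\<close> will carry
  the test functions for the conditional expectation.\<close>

lemma (in prob_space) rank_event_le:
  fixes Y :: "nat \<Rightarrow> 'a \<Rightarrow> real" and g :: "real \<Rightarrow> ennreal"
  assumes ind: "indep_vars (\<lambda>_. borel) Y {1..n}"
    and i: "i \<in> {1..n}" and j: "j \<in> {1..n}" and g[measurable]: "g \<in> borel_measurable borel"
    and tail: "\<And>\<omega>. \<omega> \<in> space M \<Longrightarrow>
      prob {\<omega>'\<in>space M. Y i \<omega>' < s * Y j \<omega>} \<le> p * prob {\<omega>'\<in>space M. Y i \<omega>' < Y j \<omega>}"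
    and p: "0 \<le> p"
  shows "(\<integral>\<^sup>+\<omega>. (if rank_in n (\<lambda>k. Y k \<omega>) j = m \<and> precedes (\<lambda>k. Y k \<omega>) i j \<and> Y i \<omega> < s * Y j \<omega>
            then g (Y j \<omega>) else 0) \<partial>M)
    \<le> ennreal p * (\<integral>\<^sup>+\<omega>. (if rank_in n (\<lambda>k. Y k \<omega>) j = m \<and> precedes (\<lambda>k. Y k \<omega>) i j
            then g (Y j \<omega>) else 0) \<partial>M)"
proof (cases "i = j")
  case True
  then show ?thesis by (simp add: precedes_def)
next
  case False
  let ?K = "{1..n} - {i}"
  \<comment> \<open>Once \<open>i\<close> precedes \<open>j\<close>, the rank of \<open>j\<close> no longer depends on \<open>Y i\<close>.\<close>
  define c where "c z = card {k\<in>?K. precedes z k j}" for z :: "nat \<Rightarrow> real"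
  have rank: "rank_in n y j = Suc (c y)" if "precedes y i j" for y
  proof -
    have "{k\<in>{1..n}. precedes y k j} = insert i {k\<in>?K. precedes y k j}"
      using that i by auto
    then show ?thesis by (simp add: rank_in_def c_def)
  qed
  let ?S = "PiM ?K (\<lambda>_. borel :: real measure)" and ?T = "PiM {i} (\<lambda>_. borel :: real measure)"
  let ?A = "\<lambda>\<omega>. restrict (\<lambda>k. Y k \<omega>) ?K" and ?B = "\<lambda>\<omega>. restrict (\<lambda>k. Y k \<omega>) {i}"
  have jK: "j \<in> ?K" using j False by simp
  have c_A: "c (?A \<omega>) = c (\<lambda>k. Y k \<omega>)" for \<omega>
  proof -
    have "{k\<in>?K. precedes (?A \<omega>) k j} = {k\<in>?K. precedes (\<lambda>k. Y k \<omega>) k j}"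
      using jK by (auto simp: precedes_def)
    then show ?thesis by (simp add: c_def)
  qed
  define Q where "Q y h \<longleftrightarrow> y < h \<or> (y = h \<and> i < j)" for y h :: real
  define \<Phi> where "\<Phi> = (\<lambda>(z, b). if Suc (c z) = m \<and> Q (b i) (z j) \<and> b i < s * z j then g (z j) else 0)"
  define \<Theta> where "\<Theta> = (\<lambda>(z, b). if Suc (c z) = m \<and> Q (b i) (z j) then g (z j) else 0)"
  define \<Psi> where "\<Psi> zb = ennreal p * \<Theta> zb" for zb
  have Yi[measurable]: "random_variable borel (Y i)" and Yj[measurable]: "random_variable borel (Y j)"
    using ind i j by (auto simp: indep_vars_def)
  have c_meas[measurable]: "c \<in> measurable ?S (count_space UNIV)"
    unfolding c_def by (rule measurable_precedes_card[of _ ?K]) (use jK in \<open>auto intro: measurable_component_singleton\<close>)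
  have [measurable]: "(\<lambda>z. z j) \<in> borel_measurable ?S" "(\<lambda>z. z i) \<in> borel_measurable ?T"
    using jK by (auto intro: measurable_component_singleton)
  have indAB: "indep_var ?S ?A ?T ?B"
    by (rule indep_var_restrict[OF ind]) (use i in auto)
  have \<Phi>: "\<Phi> \<in> borel_measurable (?S \<Otimes>\<^sub>M ?T)" and \<Theta>[measurable]: "\<Theta> \<in> borel_measurable (?S \<Otimes>\<^sub>M ?T)"
    unfolding \<Phi>_def \<Theta>_def Q_def by measurable
  have \<Psi>: "\<Psi> \<in> borel_measurable (?S \<Otimes>\<^sub>M ?T)"
    unfolding \<Psi>_def by measurable
  have le: "(\<integral>\<^sup>+\<omega>'. \<Phi> (?A \<omega>, ?B \<omega>') \<partial>M) \<le> (\<integral>\<^sup>+\<omega>'. \<Psi> (?A \<omega>, ?B \<omega>') \<partial>M)"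
    if \<omega>: "\<omega> \<in> space M" for \<omega>
  proof (cases "Suc (c (?A \<omega>)) = m")
    case True
    let ?h = "Y j \<omega>"
    have "(\<integral>\<^sup>+\<omega>'. \<Phi> (?A \<omega>, ?B \<omega>') \<partial>M) \<le> (\<integral>\<^sup>+\<omega>'. g ?h * indicator {\<omega>'\<in>space M. Y i \<omega>' < s * ?h} \<omega>' \<partial>M)"
      using True jK by (intro nn_integral_mono) (auto simp: \<Phi>_def)
    also have "\<dots> = g ?h * emeasure M {\<omega>'\<in>space M. Y i \<omega>' < s * ?h}"
      by (subst nn_integral_cmult_indicator) auto
    also have "\<dots> \<le> g ?h * (ennreal p * emeasure M {\<omega>'\<in>space M. Y i \<omega>' < ?h})"
      using tail[OF \<omega>] p
      by (intro mult_left_mono) (auto simp: emeasure_eq_measure ennreal_mult[symmetric] intro!: ennreal_leI)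
    \<comment> \<open>The event is enlarged from strictly below to \<open>Q\<close>, which may
      include a tie, so level sets of positive mass do no harm.\<close>
    also have "\<dots> \<le> g ?h * (ennreal p * emeasure M {\<omega>'\<in>space M. Q (Y i \<omega>') ?h})"
      by (intro mult_left_mono emeasure_mono) (auto simp: Q_def)
    also have "\<dots> = (\<integral>\<^sup>+\<omega>'. (g ?h * ennreal p) * indicator {\<omega>'\<in>space M. Q (Y i \<omega>') ?h} \<omega>' \<partial>M)"
      by (subst nn_integral_cmult_indicator) (auto simp: Q_def mult.assoc)
    also have "\<dots> = (\<integral>\<^sup>+\<omega>'. \<Psi> (?A \<omega>, ?B \<omega>') \<partial>M)"
      using True jK by (intro nn_integral_cong) (auto simp: \<Psi>_def \<Theta>_def mult.commute split: split_indicator)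
    finally show ?thesis .
  next
    case False
    then show ?thesis by (simp add: \<Phi>_def)
  qed
  have iff: "(rank_in n (\<lambda>k. Y k \<omega>) j = m \<and> precedes (\<lambda>k. Y k \<omega>) i j) \<longleftrightarrow>
      (Suc (c (?A \<omega>)) = m \<and> Q (?B \<omega> i) (?A \<omega> j))" for \<omega>
    using rank[of "\<lambda>k. Y k \<omega>"] jK unfolding c_A by (auto simp: precedes_def Q_def)
  have "(\<integral>\<^sup>+\<omega>. (if rank_in n (\<lambda>k. Y k \<omega>) j = m \<and> precedes (\<lambda>k. Y k \<omega>) i j \<and> Y i \<omega> < s * Y j \<omega>
            then g (Y j \<omega>) else 0) \<partial>M) = (\<integral>\<^sup>+\<omega>. \<Phi> (?A \<omega>, ?B \<omega>) \<partial>M)"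
    using jK unfolding conj_assoc[symmetric] iff by (simp add: \<Phi>_def cong: if_cong)
  also have "\<dots> \<le> (\<integral>\<^sup>+\<omega>. \<Psi> (?A \<omega>, ?B \<omega>) \<partial>M)"
    by (rule indep_var_nn_integral_mono[OF indAB \<Phi> \<Psi> le])
  also have "\<dots> = ennreal p * (\<integral>\<^sup>+\<omega>. \<Theta> (?A \<omega>, ?B \<omega>) \<partial>M)"
    unfolding \<Psi>_def
  proof (rule nn_integral_cmult)
    have "?A \<in> measurable M ?S" "?B \<in> measurable M ?T"
      using indAB unfolding indep_var_distribution_eq by auto
    then show "(\<lambda>\<omega>. \<Theta> (?A \<omega>, ?B \<omega>)) \<in> borel_measurable M"
      by (intro measurable_compose[OF measurable_Pair \<Theta>])
  qed
  finally show ?thesis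
    unfolding iff using jK by (simp add: \<Theta>_def cong: if_cong)
qed

text \<open>If the minimum is below \<open>s * W\<close>, its index precedes the index
  \<open>j\<close> of rank \<open>\<mu>\<close>. Each such pair costs a factor \<open>p\<close>, and
  \<open>j\<close> has exactly \<open>\<mu>\<close> predecessors, so the union bound costs
  \<open>\<mu>\<close> and not \<open>n\<close>.\<close>

lemma (in prob_space) order_statistics_ratio:
  fixes f :: "'b \<Rightarrow> real" and X :: "nat \<Rightarrow> 'a \<Rightarrow> 'b" and n \<mu> :: nat and g :: "real \<Rightarrow> ennreal"
  defines "V \<equiv> \<lambda>\<omega>. f (ranked f n (\<lambda>i. X i \<omega>) 1)"
    and "W \<equiv> \<lambda>\<omega>. f (ranked f n (\<lambda>i. X i \<omega>) (Suc \<mu>))"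
  assumes ind: "indep_vars (\<lambda>_. borel) (\<lambda>i \<omega>. f (X i \<omega>)) {1..n}"
    and \<mu>: "\<mu> < n" and g[measurable]: "g \<in> borel_measurable borel"
    and nonneg: "\<And>i \<omega>. i \<in> {1..n} \<Longrightarrow> \<omega> \<in> space M \<Longrightarrow> 0 \<le> f (X i \<omega>)"
    and tail: "\<And>i j \<omega>. i \<in> {1..n} \<Longrightarrow> j \<in> {1..n} \<Longrightarrow> \<omega> \<in> space M \<Longrightarrow>
      prob {\<omega>'\<in>space M. f (X i \<omega>') < s * f (X j \<omega>)} \<le> p * prob {\<omega>'\<in>space M. f (X i \<omega>') < f (X j \<omega>)}"
    and p: "0 \<le> p" and s: "s \<le> 1"
  shows "(\<integral>\<^sup>+\<omega>. (if V \<omega> < s * W \<omega> then g (W \<omega>) else 0) \<partial>M) \<le> ennreal (p * real \<mu>) * (\<integral>\<^sup>+\<omega>. g (W \<omega>) \<partial>M)"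
proof -
  let ?Y = "\<lambda>\<omega> k. f (X k \<omega>)" and ?I = "{1..n}"
  have Y[measurable]: "\<And>i. i \<in> ?I \<Longrightarrow> random_variable borel (\<lambda>\<omega>. f (X i \<omega>))"
    using ind by (auto simp: indep_vars_def)
  let ?a = "\<lambda>i j \<omega>. if rank_in n (?Y \<omega>) j = \<mu> \<and> precedes (?Y \<omega>) i j \<and> f (X i \<omega>) < s * f (X j \<omega>)
    then g (f (X j \<omega>)) else 0"
  let ?b = "\<lambda>i j \<omega>. if rank_in n (?Y \<omega>) j = \<mu> \<and> precedes (?Y \<omega>) i j then g (f (X j \<omega>)) else 0"
  have rank[measurable]: "j \<in> ?I \<Longrightarrow> (\<lambda>\<omega>. rank_in n (?Y \<omega>) j) \<in> measurable M (count_space UNIV)" for j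
    unfolding rank_in_def using Y by (intro measurable_precedes_card[of _ ?I]) auto
  have b_meas: "?b i j \<in> borel_measurable M" and a_meas: "?a i j \<in> borel_measurable M"
    if ij: "i \<in> ?I" "j \<in> ?I" for i j
  proof -
    note [measurable] = Y[OF ij(1)] Y[OF ij(2)] rank[OF ij(2)]
    show "?b i j \<in> borel_measurable M" "?a i j \<in> borel_measurable M"
      unfolding precedes_def by measurable
  qed
  have pt: "(if V \<omega> < s * W \<omega> then g (W \<omega>) else 0) \<le> (\<Sum>j\<in>?I. \<Sum>i\<in>?I. ?a i j \<omega>)"
    and pt': "(\<Sum>j\<in>?I. \<Sum>i\<in>?I. ?b i j \<omega>) = of_nat \<mu> * g (W \<omega>)" if \<omega>: "\<omega> \<in> space M" for \<omega>
  proof -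
    from ex1_rank_in[OF \<mu>, of "?Y \<omega>"] obtain j where
      j: "j \<in> ?I" "rank_in n (?Y \<omega>) j = \<mu>"
      and u: "\<And>i. i \<in> ?I \<Longrightarrow> rank_in n (?Y \<omega>) i = \<mu> \<Longrightarrow> i = j" by blast
    have W: "W \<omega> = f (X j \<omega>)"
      unfolding W_def using ranked_eqI[of j n f "\<lambda>i. X i \<omega>", OF j] by simp
    have "0 < n" using \<mu> by simp
    from ranked_mem[OF this, of f "\<lambda>i. X i \<omega>"] obtain i where i: "i \<in> ?I" "V \<omega> = f (X i \<omega>)"
      unfolding V_def by auto
    show "(if V \<omega> < s * W \<omega> then g (W \<omega>) else 0) \<le> (\<Sum>j\<in>?I. \<Sum>i\<in>?I. ?a i j \<omega>)"
    proof (cases "V \<omega> < s * W \<omega>")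
      case True
      \<comment> \<open>Together with \<open>V \<omega> < s * W \<omega>\<close> this makes the
        minimum strictly smaller than the value at \<open>j\<close>, whence
        \<open>precedes\<close>.\<close>
      have "s * f (X j \<omega>) \<le> f (X j \<omega>)"
        using mult_right_mono[OF s nonneg[OF j(1) \<omega>]] by simp
      with True have "precedes (?Y \<omega>) i j" unfolding i W precedes_def by simp
      then have "g (W \<omega>) = ?a i j \<omega>"
        using True j unfolding i W by simp
      also have "\<dots> \<le> (\<Sum>i\<in>?I. ?a i j \<omega>)"
        by (rule member_le_sum[OF i(1)]) auto
      also have "\<dots> \<le> (\<Sum>j\<in>?I. \<Sum>i\<in>?I. ?a i j \<omega>)"
        by (rule member_le_sum[OF j(1), where f = "\<lambda>j. \<Sum>i\<in>?I. ?a i j \<omega>"]) (auto intro: sum_nonneg)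
      finally show ?thesis using True by simp
    qed auto
    have "(\<Sum>k\<in>?I. \<Sum>i\<in>?I. ?b i k \<omega>) = (\<Sum>k\<in>?I. if k = j then \<Sum>i\<in>?I. ?b i j \<omega> else 0)"
    proof (rule sum.cong[OF refl])
      fix k assume "k \<in> ?I"
      then have "k \<noteq> j \<Longrightarrow> rank_in n (?Y \<omega>) k \<noteq> \<mu>" using u by blast
      then show "(\<Sum>i\<in>?I. ?b i k \<omega>) = (if k = j then \<Sum>i\<in>?I. ?b i j \<omega> else 0)" by auto
    qed
    also have "\<dots> = (\<Sum>i\<in>?I. ?b i j \<omega>)" using j(1) by (simp add: sum.delta)
    also have "\<dots> = (\<Sum>i\<in>{i\<in>?I. precedes (?Y \<omega>) i j}. g (W \<omega>))"
      unfolding W j(2) by (subst sum.inter_filter[symmetric]) auto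
    also have "\<dots> = of_nat \<mu> * g (W \<omega>)"
      using j(2) unfolding rank_in_def by simp
    finally show "(\<Sum>j\<in>?I. \<Sum>i\<in>?I. ?b i j \<omega>) = of_nat \<mu> * g (W \<omega>)" .
  qed
  have dsum: "(\<integral>\<^sup>+\<omega>. (\<Sum>j\<in>?I. \<Sum>i\<in>?I. F i j \<omega>) \<partial>M) = (\<Sum>j\<in>?I. \<Sum>i\<in>?I. \<integral>\<^sup>+\<omega>. F i j \<omega> \<partial>M)"
    if F: "\<And>i j. i \<in> ?I \<Longrightarrow> j \<in> ?I \<Longrightarrow> F i j \<in> borel_measurable M" for F :: "nat \<Rightarrow> nat \<Rightarrow> 'a \<Rightarrow> ennreal"
  proof -
    have "(\<integral>\<^sup>+\<omega>. (\<Sum>j\<in>?I. \<Sum>i\<in>?I. F i j \<omega>) \<partial>M) = (\<Sum>j\<in>?I. \<integral>\<^sup>+\<omega>. (\<Sum>i\<in>?I. F i j \<omega>) \<partial>M)"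
      by (intro nn_integral_sum borel_measurable_sum F)
    also have "\<dots> = (\<Sum>j\<in>?I. \<Sum>i\<in>?I. \<integral>\<^sup>+\<omega>. F i j \<omega> \<partial>M)"
      by (intro sum.cong refl nn_integral_sum F)
    finally show ?thesis .
  qed
  have W_meas[measurable]: "random_variable borel W"
    unfolding W_def by (rule measurable_ranked[of n f X, OF Y \<mu>])
  have "(\<integral>\<^sup>+\<omega>. (if V \<omega> < s * W \<omega> then g (W \<omega>) else 0) \<partial>M) \<le> (\<integral>\<^sup>+\<omega>. (\<Sum>j\<in>?I. \<Sum>i\<in>?I. ?a i j \<omega>) \<partial>M)"
    by (rule nn_integral_mono) (rule pt)
  also have "\<dots> = (\<Sum>j\<in>?I. \<Sum>i\<in>?I. \<integral>\<^sup>+\<omega>. ?a i j \<omega> \<partial>M)"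
    by (rule dsum) (rule a_meas)
  also have "\<dots> \<le> (\<Sum>j\<in>?I. \<Sum>i\<in>?I. ennreal p * (\<integral>\<^sup>+\<omega>. ?b i j \<omega> \<partial>M))"
    by (intro sum_mono rank_event_le[where Y = "\<lambda>i \<omega>. f (X i \<omega>)", OF ind _ _ g tail p])
  also have "\<dots> = ennreal p * (\<Sum>j\<in>?I. \<Sum>i\<in>?I. \<integral>\<^sup>+\<omega>. ?b i j \<omega> \<partial>M)"
    by (simp add: sum_distrib_left)
  also have "(\<Sum>j\<in>?I. \<Sum>i\<in>?I. \<integral>\<^sup>+\<omega>. ?b i j \<omega> \<partial>M) = (\<integral>\<^sup>+\<omega>. (\<Sum>j\<in>?I. \<Sum>i\<in>?I. ?b i j \<omega>) \<partial>M)"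
    by (rule dsum[symmetric]) (rule b_meas)
  also have "\<dots> = (\<integral>\<^sup>+\<omega>. of_nat \<mu> * g (W \<omega>) \<partial>M)"
    by (rule nn_integral_cong) (rule pt')
  also have "\<dots> = of_nat \<mu> * (\<integral>\<^sup>+\<omega>. g (W \<omega>) \<partial>M)"
    by (rule nn_integral_cmult) measurable
  finally show ?thesis
    using p by (simp add: ennreal_mult mult.assoc ennreal_of_nat_eq_real_of_nat)
qed

text \<open>On the set \<open>A\<close> where a version \<open>\<psi>\<close> is below
  \<open>c * h\<close>, the difference \<open>c * W - \<psi> W\<close> is positive, yet the assumed
  inequality makes its integral there nonpositive; so \<open>W\<close> almost surely avoids
  \<open>A\<close>. The maximum of \<open>\<psi> h\<close> and \<open>c * h\<close> is then a
  version obeying the bound at every \<open>h\<close>.\<close>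

lemma (in prob_space) cond_exp_version_ge:
  assumes V[measurable]: "integrable M V" and W: "integrable M W"
    and le: "\<And>A. A \<in> sets borel \<Longrightarrow> c * (\<integral>\<omega>. indicator A (W \<omega>) * W \<omega> \<partial>M) \<le> (\<integral>\<omega>. indicator A (W \<omega>) * V \<omega> \<partial>M)"
  shows "\<exists>\<psi>. cond_exp_version M V W \<psi> \<and> (\<forall>h. c * h \<le> \<psi> h)"
proof -
  have Wm[measurable]: "W \<in> borel_measurable M" using W by auto
  let ?F = "vimage_algebra (space M) W borel"
  have sub: "subalgebra M ?F"
    unfolding subalgebra_def using measurable_sets[OF Wm] by (auto simp: sets_vimage_algebra2)
  interpret F: finite_measure_subalgebra M ?F
    by unfold_locales (rule sub)
  let ?E = "real_cond_exp M ?F V"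
  have E: "?E \<in> borel_measurable ?F" by simp
  from vimage_algebra_factorization[OF E] obtain \<psi> where
    \<psi>[measurable]: "\<psi> \<in> borel_measurable borel" and eq: "\<And>\<omega>. \<omega> \<in> space M \<Longrightarrow> ?E \<omega> = \<psi> (W \<omega>)"
    by auto
  have Eint: "integrable M ?E" by (rule F.real_cond_exp_int[OF V])
  define A where "A = {h. \<psi> h < c * h}"
  have A[measurable]: "A \<in> sets borel" unfolding A_def by measurable
  let ?B = "W -` A \<inter> space M"
  have B: "?B \<in> sets ?F" by (rule in_vimage_algebra[OF A])
  have ind: "indicator ?B \<omega> = (indicator A (W \<omega>) :: real)" if "\<omega> \<in> space M" for \<omega>
    using that by (auto simp: indicator_def)
  have intI: "integrable M (\<lambda>\<omega>. indicator A (W \<omega>) * Z \<omega>)" if "integrable M Z" for Z :: "'a \<Rightarrow> real"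
  proof -
    have "?B \<in> sets M" by measurable
    from integrable_mult_indicator[OF this that] show ?thesis
      by (rule Bochner_Integration.integrable_cong[THEN iffD1, rotated 2]) (auto simp: ind)
  qed
  have "(\<integral>\<omega>. indicator A (W \<omega>) * V \<omega> \<partial>M) = (\<integral>\<omega>. indicator A (W \<omega>) * ?E \<omega> \<partial>M)"
    using F.real_cond_exp_intA[OF V B] unfolding set_lebesgue_integral_def
    by (simp add: ind cong: Bochner_Integration.integral_cong)
  then have "(\<integral>\<omega>. indicator A (W \<omega>) * (c * W \<omega> - ?E \<omega>) \<partial>M) \<le> 0"
    using le[OF A] intI[OF W] intI[OF Eint]
    by (simp add: right_diff_distrib mult.left_commute[of _ c])
  moreover have nn: "0 \<le> indicator A (W \<omega>) * (c * W \<omega> - ?E \<omega>)" if "\<omega> \<in> space M" for \<omega>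
    using eq[OF that] by (auto simp: indicator_def A_def)
  moreover have int: "integrable M (\<lambda>\<omega>. indicator A (W \<omega>) * (c * W \<omega> - ?E \<omega>))"
    using W Eint by (intro intI) auto
  ultimately have "(\<integral>\<omega>. indicator A (W \<omega>) * (c * W \<omega> - ?E \<omega>) \<partial>M) = 0"
    by (intro antisym integral_nonneg_AE) auto
  then have "AE \<omega> in M. indicator A (W \<omega>) * (c * W \<omega> - ?E \<omega>) = 0"
    using integral_nonneg_eq_0_iff_AE[OF int] nn by auto
  then have "AE \<omega> in M. max (\<psi> (W \<omega>)) (c * W \<omega>) = ?E \<omega>"
    by (rule AE_mp) (auto intro!: AE_I2 simp: eq A_def indicator_def split: if_splits)
  then have "cond_exp_version M V W (\<lambda>h. max (\<psi> h) (c * h))"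
    unfolding cond_exp_version_def by auto
  then show ?thesis by (intro exI[of _ "\<lambda>h. max (\<psi> h) (c * h)"]) auto
qed

text \<open>Off the event \<open>V < s * W\<close> the minimum is at least \<open>s * W\<close>, and
  that event carries at most the fraction \<open>p * \<mu> \<le> 1 / 2\<close> of the integral of
  \<open>W\<close> over any event \<open>W \<in> A\<close>. What remains gives the constant
  \<open>s / 2\<close>.\<close>

lemma (in prob_space) cond_exp_order_statistics_ge:
  fixes f :: "'b \<Rightarrow> real" and X :: "nat \<Rightarrow> 'a \<Rightarrow> 'b" and n \<mu> :: nat
  defines "V \<equiv> \<lambda>\<omega>. f (ranked f n (\<lambda>i. X i \<omega>) 1)"
    and "W \<equiv> \<lambda>\<omega>. f (ranked f n (\<lambda>i. X i \<omega>) (Suc \<mu>))"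
  assumes ind: "indep_vars (\<lambda>_. borel) (\<lambda>i \<omega>. f (X i \<omega>)) {1..n}"
    and \<mu>: "\<mu> < n"
    and bounds: "\<And>i \<omega>. i \<in> {1..n} \<Longrightarrow> \<omega> \<in> space M \<Longrightarrow> 0 \<le> f (X i \<omega>) \<and> f (X i \<omega>) \<le> S"
    and tail: "\<And>i j \<omega>. i \<in> {1..n} \<Longrightarrow> j \<in> {1..n} \<Longrightarrow> \<omega> \<in> space M \<Longrightarrow>
      prob {\<omega>'\<in>space M. f (X i \<omega>') < s * f (X j \<omega>)} \<le> p * prob {\<omega>'\<in>space M. f (X i \<omega>') < f (X j \<omega>)}"
    and p: "0 \<le> p" "p * real \<mu> \<le> 1 / 2" and s: "0 \<le> s" "s \<le> 1"
  shows "\<exists>\<psi>. cond_exp_version M V W \<psi> \<and> (\<forall>h. s / 2 * h \<le> \<psi> h)"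
proof (rule cond_exp_version_ge)
  have Y: "\<And>i. i \<in> {1..n} \<Longrightarrow> random_variable borel (\<lambda>\<omega>. f (X i \<omega>))"
    using ind by (auto simp: indep_vars_def)
  have Wm[measurable]: "random_variable borel W"
    unfolding W_def by (rule measurable_ranked[of n f X, OF Y \<mu>])
  have n0: "0 < n" using \<mu> by simp
  have Vm[measurable]: "random_variable borel V"
    unfolding V_def using measurable_ranked[of n f X, OF Y n0] by simp
  have WS: "0 \<le> W \<omega> \<and> W \<omega> \<le> S" if "\<omega> \<in> space M" for \<omega>
    using ranked_mem[OF \<mu>, of f "\<lambda>i. X i \<omega>"] bounds[OF _ that] unfolding W_def by auto
  have VS: "0 \<le> V \<omega> \<and> V \<omega> \<le> S" if "\<omega> \<in> space M" for \<omega>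
    using ranked_mem[OF n0, of f "\<lambda>i. X i \<omega>"] bounds[OF _ that] unfolding V_def by auto
  obtain \<omega>\<^sub>0 where "\<omega>\<^sub>0 \<in> space M" using not_empty by blast
  from VS[OF this] have S: "0 \<le> S" by simp
  show "integrable M V"
    by (rule integrable_const_bound[of _ S]) (use VS in auto)
  show "integrable M W"
    by (rule integrable_const_bound[of _ S]) (use WS in auto)
  fix A :: "real set" assume A[measurable]: "A \<in> sets borel"
  \<comment> \<open>\<open>?u\<close> is the test integrand and \<open>?w\<close> its part on the
    bad event, so \<open>?u - ?w\<close> lives where \<open>s * W \<le> V\<close>.\<close>
  let ?u = "\<lambda>\<omega>. indicator A (W \<omega>) * W \<omega>"
  let ?w = "\<lambda>\<omega>. if V \<omega> < s * W \<omega> then ?u \<omega> else 0"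
  have ui: "integrable M ?u"
    by (rule integrable_const_bound[of _ S]) (use WS S in \<open>auto simp: indicator_def intro!: AE_I2\<close>)
  have wi: "integrable M ?w"
    by (rule integrable_const_bound[of _ S]) (use WS S in \<open>auto simp: indicator_def intro!: AE_I2\<close>)
  have vi: "integrable M (\<lambda>\<omega>. indicator A (W \<omega>) * V \<omega>)"
    by (rule integrable_const_bound[of _ S]) (use VS S in \<open>auto simp: indicator_def intro!: AE_I2\<close>)
  have u0: "0 \<le> ?u \<omega>" if "\<omega> \<in> space M" for \<omega> using WS[OF that] by simp
  have "ennreal (\<integral>\<omega>. ?w \<omega> \<partial>M) = (\<integral>\<^sup>+\<omega>. ennreal (?w \<omega>) \<partial>M)"
    using wi u0 by (intro nn_integral_eq_integral[symmetric]) auto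
  also have "\<dots> = (\<integral>\<^sup>+\<omega>. (if V \<omega> < s * W \<omega> then ennreal (indicator A (W \<omega>) * W \<omega>) else 0) \<partial>M)"
    by (intro nn_integral_cong) auto
  also have "\<dots> \<le> ennreal (p * real \<mu>) * (\<integral>\<^sup>+\<omega>. ennreal (indicator A (W \<omega>) * W \<omega>) \<partial>M)"
    unfolding V_def W_def
    by (rule order_statistics_ratio[of f X n, OF ind \<mu>, of "\<lambda>h. ennreal (indicator A h * h)" s p])
       (use bounds tail p s in auto)
  also have "\<dots> = ennreal (p * real \<mu>) * ennreal (\<integral>\<omega>. ?u \<omega> \<partial>M)"
    using ui u0 by (subst nn_integral_eq_integral) auto
  also have "\<dots> = ennreal (p * real \<mu> * (\<integral>\<omega>. ?u \<omega> \<partial>M))"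
    using p u0 by (intro ennreal_mult[symmetric] integral_nonneg_AE) auto
  finally have "(\<integral>\<omega>. ?w \<omega> \<partial>M) \<le> p * real \<mu> * (\<integral>\<omega>. ?u \<omega> \<partial>M)"
    using p u0 by (subst (asm) ennreal_le_iff) (auto intro!: mult_nonneg_nonneg integral_nonneg_AE)
  also have "\<dots> \<le> 1 / 2 * (\<integral>\<omega>. ?u \<omega> \<partial>M)"
    using p u0 by (intro mult_right_mono integral_nonneg_AE) auto
  finally have half: "(\<integral>\<omega>. ?w \<omega> \<partial>M) \<le> 1 / 2 * (\<integral>\<omega>. ?u \<omega> \<partial>M)" .
  have "s / 2 * (\<integral>\<omega>. ?u \<omega> \<partial>M) \<le> s * ((\<integral>\<omega>. ?u \<omega> \<partial>M) - (\<integral>\<omega>. ?w \<omega> \<partial>M))"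
    using mult_left_mono[OF half s(1)] by (simp add: algebra_simps)
  also have "\<dots> = (\<integral>\<omega>. s * (?u \<omega> - ?w \<omega>) \<partial>M)"
    using ui wi by simp
  also have "\<dots> \<le> (\<integral>\<omega>. indicator A (W \<omega>) * V \<omega> \<partial>M)"
  proof (rule integral_mono)
    show "integrable M (\<lambda>\<omega>. s * (?u \<omega> - ?w \<omega>))" using ui wi by simp
  qed (use vi VS in \<open>auto simp: indicator_def\<close>)
  finally show "s / 2 * (\<integral>\<omega>. ?u \<omega> \<partial>M) \<le> (\<integral>\<omega>. indicator A (W \<omega>) * V \<omega> \<partial>M)" .
qed

section \<open>Sublevel sets of the objective\<close>

text \<open>The quadratic form attains positive extreme values on the compact unit sphere; these are
  \<open>a\<close> and \<open>b\<close>, and homogeneity of degree two extends the bounds to all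
  vectors.\<close>

lemma mat_norm_bounds:
  fixes H :: "real^'n^'n"
  assumes "sym_pos_def H"
  shows "\<exists>a>0. \<exists>b>0. \<forall>y. a * (norm y)\<^sup>2 \<le> (mat_norm H y)\<^sup>2 \<and> (mat_norm H y)\<^sup>2 \<le> b * (norm y)\<^sup>2"
proof -
  let ?q = "\<lambda>y. y \<bullet> (H *v y)"
  have pos: "0 < ?q y" if "y \<noteq> 0" for y using assms that by (auto simp: sym_pos_def_def)
  have nn: "0 \<le> ?q y" for y using pos[of y] by (cases "y = 0") auto
  have sq: "(mat_norm H y)\<^sup>2 = ?q y" for y unfolding mat_norm_def using nn by simp
  have cont: "continuous_on (sphere 0 1) ?q"
    by (intro continuous_intros linear_continuous_on_compose[OF continuous_on_id] matrix_vector_mul_linear)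
  have ne: "sphere (0::real^'n) 1 \<noteq> {}" by simp
  obtain y0 where y0: "y0 \<in> sphere 0 1" "\<And>y. y \<in> sphere 0 1 \<Longrightarrow> ?q y0 \<le> ?q y"
    using continuous_attains_inf[OF compact_sphere ne cont] by blast
  obtain y1 where y1: "y1 \<in> sphere 0 1" "\<And>y. y \<in> sphere 0 1 \<Longrightarrow> ?q y \<le> ?q y1"
    using continuous_attains_sup[OF compact_sphere ne cont] by blast
  have scale: "?q y = (norm y)\<^sup>2 * ?q (y /\<^sub>R norm y)" for y
    by (cases "y = 0") (auto simp: matrix_vector_mult_scaleR power2_eq_square field_simps)
  have "?q y0 * (norm y)\<^sup>2 \<le> ?q y \<and> ?q y \<le> ?q y1 * (norm y)\<^sup>2" for y
  proof (cases "y = 0")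
    case False
    then have "y /\<^sub>R norm y \<in> sphere 0 1" by simp
    from y0(2)[OF this] y1(2)[OF this] show ?thesis
      unfolding scale[of y] mult.commute[of _ "(norm y)\<^sup>2"] by (intro conjI mult_left_mono) simp_all
  qed simp
  moreover have "0 < ?q y0" "0 < ?q y1" using y0(1) y1(1) by (auto intro!: pos)
  ultimately show ?thesis unfolding sq by blast
qed

text \<open>Near \<open>xs\<close> the quadratic term dominates the error because
  \<open>\<alpha> > 2\<close>; away from \<open>xs\<close>, compactness and uniqueness of the
  minimizer keep \<open>f\<close> above a positive constant. The upper bound comes from boundedness
  of the error factor on the ball.\<close>

lemma assumption_A_quadratic_bounds:
  fixes f :: "real^'n \<Rightarrow> real"
  assumes r: "r > 0" and A: "assumption_A r f"
  shows "\<exists>xs. norm xs < r \<and> (\<exists>c>0. \<exists>C\<ge>c. \<forall>x\<in>cball 0 r.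
     c * (norm (x - xs))\<^sup>2 \<le> f x \<and> f x \<le> C * (norm (x - xs))\<^sup>2)"
proof -
  from A obtain xs H \<alpha> \<epsilon> M where cont: "continuous_on (cball 0 r) f"
    and amin: "\<And>x. is_arg_min f (\<lambda>y. y \<in> cball 0 r) x \<longleftrightarrow> x = xs"
    and xs: "norm xs < r" "f xs = 0"
    and H: "sym_pos_def H" and \<alpha>: "\<alpha> > 2" and M: "M > 0" "\<And>y. \<bar>\<epsilon> y\<bar> \<le> M"
    and f: "\<And>x. x \<in> cball 0 r \<Longrightarrow>
      f x = (mat_norm H (x - xs))\<^sup>2 + mat_norm H (x - xs) powr \<alpha> * \<epsilon> (x - xs)"
    unfolding assumption_A_def by blast
  from mat_norm_bounds[OF H] obtain a b where a: "a > 0" and b: "b > 0"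
    and ab: "\<And>y. a * (norm y)\<^sup>2 \<le> (mat_norm H y)\<^sup>2" "\<And>y. (mat_norm H y)\<^sup>2 \<le> b * (norm y)\<^sup>2" by blast
  define N where "N x = mat_norm H (x - xs)" for x
  have N0: "0 \<le> N x" for x
    unfolding N_def mat_norm_def using H by (cases "x = xs") (auto simp: sym_pos_def_def intro: less_imp_le)
  \<comment> \<open>Also correct at \<open>N x = 0\<close>, because \<open>0 powr z = 0\<close> for
    every \<open>z\<close>.\<close>
  have f': "f x = (N x)\<^sup>2 * (1 + N x powr (\<alpha> - 2) * \<epsilon> (x - xs))" if "x \<in> cball 0 r" for x
  proof -
    have "N x powr \<alpha> = (N x)\<^sup>2 * N x powr (\<alpha> - 2)"
    proof (cases "N x = 0")
      case False
      then have "N x > 0" using N0[of x] by simp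
      then have "(N x)\<^sup>2 = N x powr 2" by simp
      then show ?thesis by (simp add: powr_add[symmetric])
    qed simp
    then show ?thesis using f[OF that] unfolding N_def[symmetric] by (simp add: algebra_simps)
  qed
  have dist: "norm (x - xs) \<le> 2 * r" if "x \<in> cball 0 r" for x
    using that xs norm_triangle_ineq4[of x xs] by simp
  define R where "R = sqrt b * (2 * r)"
  have NR: "N x \<le> R" if "x \<in> cball 0 r" for x
  proof (rule power2_le_imp_le)
    have "(N x)\<^sup>2 \<le> b * (norm (x - xs))\<^sup>2" unfolding N_def by (rule ab)
    also have "\<dots> \<le> b * (2 * r)\<^sup>2" using b dist[OF that] by (intro mult_left_mono power_mono) auto
    also have "\<dots> = R\<^sup>2" using b by (simp add: R_def power_mult_distrib)
    finally show "(N x)\<^sup>2 \<le> R\<^sup>2" .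
    show "0 \<le> R" using b r by (simp add: R_def)
  qed
  define C where "C = b * (1 + R powr (\<alpha> - 2) * M)"
  have upper: "f x \<le> C * (norm (x - xs))\<^sup>2" if x: "x \<in> cball 0 r" for x
  proof -
    have "\<epsilon> (x - xs) \<le> M" using M(2)[of "x - xs"] by simp
    then have "N x powr (\<alpha> - 2) * \<epsilon> (x - xs) \<le> N x powr (\<alpha> - 2) * M"
      by (intro mult_left_mono) auto
    also have "\<dots> \<le> R powr (\<alpha> - 2) * M"
      using NR[OF x] N0[of x] M \<alpha> by (intro mult_right_mono powr_mono2) auto
    finally have "f x \<le> (N x)\<^sup>2 * (1 + R powr (\<alpha> - 2) * M)"
      unfolding f'[OF x] by (intro mult_left_mono) auto
    also have "\<dots> \<le> (b * (norm (x - xs))\<^sup>2) * (1 + R powr (\<alpha> - 2) * M)"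
      unfolding N_def using M by (intro mult_right_mono ab add_nonneg_nonneg) auto
    finally show ?thesis by (simp add: C_def algebra_simps)
  qed
  \<comment> \<open>Solves \<open>\<delta> powr (\<alpha> - 2) * M = 1 / 2\<close>, so for
    \<open>N x \<le> \<delta>\<close> the error removes at most half of the quadratic term.\<close>
  define \<delta> where "\<delta> = (1 / (2 * M)) powr (1 / (\<alpha> - 2))"
  have \<delta>: "\<delta> > 0" using M by (simp add: \<delta>_def)
  have near: "a / 2 * (norm (x - xs))\<^sup>2 \<le> f x" if x: "x \<in> cball 0 r" and "N x \<le> \<delta>" for x
  proof -
    have "N x powr (\<alpha> - 2) \<le> \<delta> powr (\<alpha> - 2)"
      using that N0 \<alpha> by (intro powr_mono2) auto
    also have "\<dots> = 1 / (2 * M)" using \<alpha> M by (simp add: \<delta>_def powr_powr)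
    finally have "N x powr (\<alpha> - 2) * M \<le> 1 / 2" using M by (simp add: field_simps)
    moreover have "N x powr (\<alpha> - 2) * (- M) \<le> N x powr (\<alpha> - 2) * \<epsilon> (x - xs)"
      using M(2)[of "x - xs"] by (intro mult_left_mono) auto
    ultimately have "1 / 2 \<le> 1 + N x powr (\<alpha> - 2) * \<epsilon> (x - xs)" by simp
    then have "(N x)\<^sup>2 * (1 / 2) \<le> f x" unfolding f'[OF x] by (intro mult_left_mono) auto
    moreover have "a * (norm (x - xs))\<^sup>2 \<le> (N x)\<^sup>2" unfolding N_def by (rule ab)
    ultimately show ?thesis by simp
  qed
  have min0: "0 \<le> f x" if "x \<in> cball 0 r" for x
    using amin[of xs] that xs by (auto simp: is_arg_min_def not_less)
  have pos: "0 < f x" if x: "x \<in> cball 0 r" "x \<noteq> xs" for x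
  proof (rule ccontr)
    assume "\<not> 0 < f x"
    with min0[OF x(1)] have "f x = 0" by simp
    then have "is_arg_min f (\<lambda>y. y \<in> cball 0 r) x"
      using x min0 by (auto simp: is_arg_min_def not_less)
    with amin x show False by simp
  qed
  \<comment> \<open>Since \<open>N xs = 0 < \<delta>\<close>, the point \<open>xs\<close> lies
    outside this compact set and \<open>f\<close> is positive on it. The set may be empty.\<close>
  define K where "K = cball 0 r \<inter> {x. \<delta> \<le> N x}"
  have contN: "continuous_on UNIV N"
    unfolding N_def mat_norm_def
    by (intro continuous_intros linear_continuous_on_compose[OF _ matrix_vector_mul_linear])
  have "closed {x. \<delta> \<le> N x}"
    by (intro closed_Collect_le continuous_on_const contN)
  then have "compact K" unfolding K_def by (intro compact_Int_closed) auto
  have "\<exists>\<eta>>0. \<forall>x\<in>K. \<eta> \<le> f x"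
  proof (cases "K = {}")
    case False
    have "continuous_on K f" using cont by (rule continuous_on_subset) (auto simp: K_def)
    from continuous_attains_inf[OF \<open>compact K\<close> False this] obtain k where
      k: "k \<in> K" "\<And>x. x \<in> K \<Longrightarrow> f k \<le> f x" by blast
    have "k \<noteq> xs" using k(1) \<delta> by (auto simp: K_def N_def mat_norm_def)
    then have "0 < f k" using k(1) by (intro pos) (auto simp: K_def)
    with k(2) show ?thesis by blast
  qed (auto intro: exI[of _ 1])
  then obtain \<eta> where \<eta>: "\<eta> > 0" "\<And>x. x \<in> K \<Longrightarrow> \<eta> \<le> f x" by blast
  \<comment> \<open>The first entry serves near \<open>xs\<close>, the second on \<open>K\<close>,
    where \<open>norm (x - xs) \<le> 2 * r\<close> keeps the quadratic at most
    \<open>\<eta>\<close>.\<close>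
  define c where "c = min (a / 2) (\<eta> / (2 * r)\<^sup>2)"
  have c: "c > 0" using a \<eta> r by (simp add: c_def)
  have lower: "c * (norm (x - xs))\<^sup>2 \<le> f x" if x: "x \<in> cball 0 r" for x
  proof (cases "N x \<le> \<delta>")
    case True
    have "c * (norm (x - xs))\<^sup>2 \<le> a / 2 * (norm (x - xs))\<^sup>2"
      by (intro mult_right_mono) (auto simp: c_def)
    with near[OF x True] show ?thesis by simp
  next
    case False
    then have "x \<in> K" using x by (simp add: K_def)
    have "c * (norm (x - xs))\<^sup>2 \<le> \<eta> / (2 * r)\<^sup>2 * (2 * r)\<^sup>2"
      using dist[OF x] \<eta> by (intro mult_mono power_mono) (auto simp: c_def)
    also have "\<dots> = \<eta>" using r by simp
    finally show ?thesis using \<eta>(2)[OF \<open>x \<in> K\<close>] by simp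
  qed
  \<comment> \<open>The maximum secures the required order of the two constants.\<close>
  have "\<forall>x\<in>cball (0::real^'n) r. c * (norm (x - xs))\<^sup>2 \<le> f x \<and> f x \<le> max c C * (norm (x - xs))\<^sup>2"
  proof
    fix x :: "real^'n" assume x: "x \<in> cball 0 r"
    have "C * (norm (x - xs))\<^sup>2 \<le> max c C * (norm (x - xs))\<^sup>2" by (intro mult_right_mono) auto
    with lower[OF x] upper[OF x]
    show "c * (norm (x - xs))\<^sup>2 \<le> f x \<and> f x \<le> max c C * (norm (x - xs))\<^sup>2" by simp
  qed
  then show ?thesis using xs(1) c by (intro exI[of _ xs] conjI exI[of _ c] exI[of _ "max c C"]) auto
qed

section \<open>Probabilities of sublevel sets under the uniform law\<close>

lemma measure_cball_ratio:
  fixes a :: "real^'n"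
  assumes "0 < r" "0 \<le> \<rho>"
  shows "measure lborel (cball a \<rho>) / measure lborel (cball (0::real^'n) r) = (\<rho> / r) ^ CARD('n)"
proof -
  have "unit_ball_vol (real CARD('n)) \<noteq> 0"
    by (intro less_imp_neq[THEN not_sym] unit_ball_vol_pos) simp
  then show ?thesis
    using assms by (simp add: content_cball power_divide)
qed

lemma cball_fmeasurable_lborel: "cball (a::'b::euclidean_space) \<rho> \<in> fmeasurable lborel"
  using emeasure_lborel_cball_finite[of a \<rho>] by (intro fmeasurableI) auto

text \<open>Serves to pass independence from the Borel extension of \<open>f\<close> by zero to
  \<open>f\<close> itself, as the two agree along the sample points.\<close>

lemma (in prob_space) indep_vars_cong_on_space:
  assumes X: "indep_vars M' X I" and eq: "\<And>i \<omega>. i \<in> I \<Longrightarrow> \<omega> \<in> space M \<Longrightarrow> X i \<omega> = Y i \<omega>"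
  shows "indep_vars M' Y I"
proof -
  have "X i -` A \<inter> space M = Y i -` A \<inter> space M" if "i \<in> I" for i A
    using eq[OF that] by auto
  then have "indep_sets (\<lambda>i. {X i -` A \<inter> space M | A. A \<in> sets (M' i)}) I \<longleftrightarrow>
      indep_sets (\<lambda>i. {Y i -` A \<inter> space M | A. A \<in> sets (M' i)}) I"
    by (intro indep_sets_cong) simp_all
  moreover have "random_variable (M' i) (X i) \<longleftrightarrow> random_variable (M' i) (Y i)" if "i \<in> I" for i
    using eq[OF that] by (rule measurable_cong)
  ultimately show ?thesis
    using X unfolding indep_vars_def2 by simp
qed

text \<open>Continuity is given on the ball only, so measurability comes from the extension by zero;
  \<open>X\<close> stays in the ball surely, so the event is exactly the preimage of the sublevel
  set.\<close>

lemma (in prob_space) prob_sublevel: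
  fixes f :: "real^'n \<Rightarrow> real"
  assumes r: "0 < r" and X[measurable]: "random_variable borel X" and ball: "X \<in> space M \<rightarrow> cball 0 r"
    and distr: "distr M borel X = uniform_measure lborel (cball 0 r)"
    and cont: "continuous_on (cball 0 r) f"
  shows "{x\<in>cball 0 r. f x < t} \<in> sets borel"
    and "prob {\<omega>\<in>space M. f (X \<omega>) < t} =
      measure lborel {x\<in>cball 0 r. f x < t} / measure lborel (cball (0::real^'n) r)"
proof -
  let ?L = "{x\<in>cball 0 r. f x < t}"
  have [measurable]: "(\<lambda>x. indicator (cball 0 r) x *\<^sub>R f x) \<in> borel_measurable borel"
    using cont by (intro borel_measurable_continuous_on_indicator) auto
  have "?L = cball 0 r \<inter> {x. indicator (cball 0 r) x *\<^sub>R f x < t}"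
    by (auto simp: indicator_def)
  also have "\<dots> \<in> sets borel" by measurable
  finally show L: "?L \<in> sets borel" .
  have "{\<omega>\<in>space M. f (X \<omega>) < t} = X -` ?L \<inter> space M" using ball by auto
  then have "prob {\<omega>\<in>space M. f (X \<omega>) < t} = measure (distr M borel X) ?L"
    using L by (simp add: measure_distr)
  also have "\<dots> = measure lborel (cball 0 r \<inter> ?L) / measure lborel (cball (0::real^'n) r)"
    unfolding distr
  proof (rule measure_uniform_measure)
    show "emeasure lborel (cball (0::real^'n) r) \<noteq> 0"
      using content_cball_pos[OF r, of "0::real^'n"] by (auto simp: measure_def)
    show "emeasure lborel (cball (0::real^'n) r) \<noteq> \<infinity>"
      using emeasure_lborel_cball_finite[of "0::real^'n" r] by simp
    show "?L \<in> sets lborel" using L by simp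
  qed
  also have "cball 0 r \<inter> ?L = ?L" by auto
  finally show "prob {\<omega>\<in>space M. f (X \<omega>) < t} =
      measure lborel ?L / measure lborel (cball (0::real^'n) r)" .
qed

text \<open>Quadratic growth from below confines the sublevel set to a ball around \<open>a\<close>.
  That ball may leave the domain, which only weakens an upper bound.\<close>

lemma (in prob_space) prob_sublevel_le:
  fixes f :: "real^'n \<Rightarrow> real"
  assumes r: "0 < r" and X: "random_variable borel X" "X \<in> space M \<rightarrow> cball 0 r"
    "distr M borel X = uniform_measure lborel (cball 0 r)"
    and cont: "continuous_on (cball 0 r) f"
    and c: "0 < c" and lower: "\<And>x. x \<in> cball 0 r \<Longrightarrow> c * (norm (x - a))\<^sup>2 \<le> f x"
    and \<rho>: "0 \<le> \<rho>"
  shows "prob {\<omega>\<in>space M. f (X \<omega>) < c * \<rho>\<^sup>2} \<le> (\<rho> / r) ^ CARD('n)"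
proof -
  have "{x\<in>cball 0 r. f x < c * \<rho>\<^sup>2} \<subseteq> cball a \<rho>"
  proof
    fix x assume x: "x \<in> {x\<in>cball 0 r. f x < c * \<rho>\<^sup>2}"
    then have "c * (norm (x - a))\<^sup>2 < c * \<rho>\<^sup>2" using lower[of x] by auto
    then have "norm (x - a) < \<rho>" using c \<rho> by (simp add: power_less_imp_less_base)
    then show "x \<in> cball a \<rho>" by (simp add: dist_norm norm_minus_commute)
  qed
  then have "measure lborel {x\<in>cball 0 r. f x < c * \<rho>\<^sup>2} \<le> measure lborel (cball a \<rho>)"
    using prob_sublevel(1)[OF r X cont] by (intro measure_mono_fmeasurable cball_fmeasurable_lborel) auto
  then show ?thesis
    unfolding prob_sublevel(2)[OF r X cont] measure_cball_ratio[OF r \<rho>, of a, symmetric]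
    by (intro divide_right_mono) auto
qed

text \<open>The sublevel set contains a ball around \<open>a\<close>. This ball has to stay in the
  domain, hence \<open>\<rho> \<le> r - norm a\<close>, and strictly below the level, hence
  \<open>C * \<rho>\<^sup>2 < h\<close>.\<close>

lemma (in prob_space) prob_sublevel_ge:
  fixes f :: "real^'n \<Rightarrow> real"
  assumes r: "0 < r" and X: "random_variable borel X" "X \<in> space M \<rightarrow> cball 0 r"
    "distr M borel X = uniform_measure lborel (cball 0 r)"
    and cont: "continuous_on (cball 0 r) f"
    and C: "0 < C" and upper: "\<And>x. x \<in> cball 0 r \<Longrightarrow> f x \<le> C * (norm (x - a))\<^sup>2"
    and \<rho>: "0 \<le> \<rho>" "\<rho> \<le> r - norm a" and h: "C * \<rho>\<^sup>2 < h"
  shows "(\<rho> / r) ^ CARD('n) \<le> prob {\<omega>\<in>space M. f (X \<omega>) < h}"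
proof -
  have "cball a \<rho> \<subseteq> {x\<in>cball 0 r. f x < h}"
  proof
    fix x assume "x \<in> cball a \<rho>"
    then have x: "norm (x - a) \<le> \<rho>" by (simp add: dist_norm norm_minus_commute)
    have "x \<in> cball 0 r" using x \<rho> norm_triangle_ineq[of "x - a" a] by simp
    moreover have "C * (norm (x - a))\<^sup>2 \<le> C * \<rho>\<^sup>2" using x C by (intro mult_left_mono power_mono) auto
    ultimately show "x \<in> {x\<in>cball 0 r. f x < h}" using upper[of x] h by auto
  qed
  then have "measure lborel (cball a \<rho>) \<le> measure lborel {x\<in>cball 0 r. f x < h}"
    using prob_sublevel(1)[OF r X cont]
    by (intro measure_mono_fmeasurable fmeasurableI2[OF cball_fmeasurable_lborel[of 0 r]]) auto
  then show ?thesis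
    unfolding prob_sublevel(2)[OF r X cont] measure_cball_ratio[OF r \<rho>(1), of a, symmetric]
    by (intro divide_right_mono) auto
qed

section \<open>Lower bounds for the minimum\<close>

text \<open>By the union bound the minimum is at least \<open>t\<close> with probability at least
  \<open>1 / 2\<close>; Markov's inequality then bounds the expectation.\<close>

lemma (in prob_space) expectation_min_ge:
  fixes f :: "'b \<Rightarrow> real" and X :: "nat \<Rightarrow> 'a \<Rightarrow> 'b" and n :: nat
  defines "V \<equiv> \<lambda>\<omega>. f (ranked f n (\<lambda>i. X i \<omega>) 1)"
  assumes Y: "\<And>i. i \<in> {1..n} \<Longrightarrow> random_variable borel (\<lambda>\<omega>. f (X i \<omega>))"
    and n: "0 < n"
    and bounds: "\<And>i \<omega>. i \<in> {1..n} \<Longrightarrow> \<omega> \<in> space M \<Longrightarrow> 0 \<le> f (X i \<omega>) \<and> f (X i \<omega>) \<le> S"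
    and tail: "\<And>i. i \<in> {1..n} \<Longrightarrow> prob {\<omega>\<in>space M. f (X i \<omega>) < t} \<le> 1 / (2 * real n)"
    and t: "0 \<le> t"
  shows "t / 2 \<le> expectation V"
proof -
  have Vm[measurable]: "random_variable borel V"
    unfolding V_def using measurable_ranked[of n f X, OF Y n] by simp
  have V: "\<exists>i\<in>{1..n}. V \<omega> = f (X i \<omega>)" for \<omega>
    using ranked_mem[OF n, of f "\<lambda>i. X i \<omega>"] unfolding V_def by auto
  have VS: "0 \<le> V \<omega> \<and> V \<omega> \<le> S" if "\<omega> \<in> space M" for \<omega>
    using V[of \<omega>] bounds[OF _ that] by auto
  have Vi: "integrable M V"
    by (rule integrable_const_bound[of _ S]) (use VS in auto)
  have ev: "{\<omega>\<in>space M. f (X i \<omega>) < t} \<in> events" if "i \<in> {1..n}" for i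
    using Y[OF that] by measurable
  have "{\<omega>\<in>space M. V \<omega> < t} \<subseteq> (\<Union>i\<in>{1..n}. {\<omega>\<in>space M. f (X i \<omega>) < t})"
  proof
    fix \<omega> assume "\<omega> \<in> {\<omega>\<in>space M. V \<omega> < t}"
    with V[of \<omega>] show "\<omega> \<in> (\<Union>i\<in>{1..n}. {\<omega>\<in>space M. f (X i \<omega>) < t})" by auto
  qed
  then have "prob {\<omega>\<in>space M. V \<omega> < t} \<le> prob (\<Union>i\<in>{1..n}. {\<omega>\<in>space M. f (X i \<omega>) < t})"
    using ev by (intro finite_measure_mono) auto
  also have "\<dots> \<le> (\<Sum>i\<in>{1..n}. prob {\<omega>\<in>space M. f (X i \<omega>) < t})"
    using ev by (intro finite_measure_subadditive_finite) auto
  also have "\<dots> \<le> (\<Sum>i\<in>{1..n}. 1 / (2 * real n))"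
    by (intro sum_mono tail)
  also have "\<dots> = 1 / 2" using n by simp
  finally have "1 / 2 \<le> 1 - prob {\<omega>\<in>space M. V \<omega> < t}" by simp
  also have "\<dots> = prob {\<omega>\<in>space M. t \<le> V \<omega>}"
    by (subst prob_compl[symmetric]) (auto intro!: arg_cong[where f = prob])
  finally have half: "1 / 2 \<le> prob {\<omega>\<in>space M. t \<le> V \<omega>}" .
  have "t / 2 \<le> t * prob {\<omega>\<in>space M. t \<le> V \<omega>}"
    using mult_left_mono[OF half t] by simp
  also have "\<dots> = expectation (\<lambda>\<omega>. t * indicator {\<omega>\<in>space M. t \<le> V \<omega>} \<omega>)"
    by simp
  also have "\<dots> \<le> expectation V"
  proof (rule integral_mono)
    show "integrable M (\<lambda>\<omega>. t * indicator {\<omega>\<in>space M. t \<le> V \<omega>} \<omega>)"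
      by (intro integrable_mult_right integrable_real_indicator) (auto simp: emeasure_eq_measure)
  qed (use Vi VS in \<open>auto simp: indicator_def\<close>)
  finally show ?thesis .
qed

theorem lemma4:
  fixes f :: "real^'n \<Rightarrow> real" and r :: real
  assumes "r > 0" and "assumption_A r f"
  shows
    "(\<exists>C1>0. \<exists>lam1. \<forall>lam\<ge>lam1. \<forall>(M :: 'a measure) X.
        iid_uniform_ball M r lam X \<longrightarrow>
        prob_space.expectation M (\<lambda>\<omega>. f (ranked f lam (\<lambda>i. X i \<omega>) 1))
          \<ge> C1 * real lam powr (- 2 / real CARD('n)))
     \<and>
     (\<forall>\<mu> :: nat \<Rightarrow> nat.
        (\<forall>lam\<ge>2. 1 \<le> \<mu> lam \<and> \<mu> lam \<le> lam - 1) \<and> filterlim \<mu> at_top sequentially \<longrightarrow>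
        (\<exists>C2>0. \<exists>lam2. \<forall>lam\<ge>lam2. \<forall>(M :: 'a measure) X.
           iid_uniform_ball M r lam X \<longrightarrow>
           (\<exists>\<psi>. cond_exp_version M
                   (\<lambda>\<omega>. f (ranked f lam (\<lambda>i. X i \<omega>) 1))
                   (\<lambda>\<omega>. f (ranked f lam (\<lambda>i. X i \<omega>) (\<mu> lam + 1))) \<psi> \<and>
                (\<forall>h\<in>{0..SUP x\<in>cball 0 r. f x}.
                   \<psi> h \<ge> C2 * h * real (\<mu> lam) powr (- 2 / real CARD('n))))))"
proof -
  let ?d = "CARD('n)"
  have r: "r > 0" by fact
  have cont: "continuous_on (cball 0 r) f" using assms(2) by (simp add: assumption_A_def)
  from assumption_A_quadratic_bounds[OF assms] obtain a c C where a: "norm a < r"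
    and c: "c > 0" and C: "c \<le> C"
    and lower: "\<And>x. x \<in> cball 0 r \<Longrightarrow> c * (norm (x - a))\<^sup>2 \<le> f x"
    and upper: "\<And>x. x \<in> cball 0 r \<Longrightarrow> f x \<le> C * (norm (x - a))\<^sup>2" by blast
  have C0: "C > 0" using c C by simp
  have bounds: "0 \<le> f x \<and> f x \<le> C * (2 * r)\<^sup>2" if x: "x \<in> cball 0 r" for x
  proof
    have "0 \<le> c * (norm (x - a))\<^sup>2" using c by simp
    with lower[OF x] show "0 \<le> f x" by simp
    have "norm (x - a) \<le> 2 * r" using x a norm_triangle_ineq4[of x a] by simp
    then have "C * (norm (x - a))\<^sup>2 \<le> C * (2 * r)\<^sup>2" using C0 by (intro mult_left_mono power_mono) auto
    with upper[OF x] show "f x \<le> C * (2 * r)\<^sup>2" by simp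
  qed
  \<comment> \<open>Shrinking a radius by the factor \<open>q m\<close> divides the volume of a ball
    by \<open>2 * m\<close>; the square of \<open>q m\<close> is the source of the rate
    \<open>m powr (- 2 / d)\<close>.\<close>
  define q where "q m = (2 * real m) powr (- 1 / real ?d)" for m :: nat
  have q_power: "q m ^ ?d = 1 / (2 * real m)" if "0 < m" for m
    unfolding q_def using that by (subst powr_power) (auto simp: powr_minus_divide)
  have q_sq: "(q m)\<^sup>2 = 2 powr (- 2 / real ?d) * real m powr (- 2 / real ?d)" if "0 < m" for m
    unfolding q_def using that by (subst powr_power) (auto simp: powr_mult)
  have q0: "0 \<le> q m" for m by (simp add: q_def)
  have q1: "q m \<le> 1" if "0 < m" for m
    unfolding q_def using that powr_mono[of "- 1 / real ?d" 0 "2 * real m"] by simp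
  have sample: "X i \<in> borel_measurable M" "X i \<in> space M \<rightarrow> cball 0 r"
      "distr M borel (X i) = uniform_measure lborel (cball 0 r)" "prob_space M"
    if "iid_uniform_ball M r n X" "i \<in> {1..n}" for M :: "'a measure" and X n i
    using that by (auto simp: iid_uniform_ball_def prob_space.indep_vars_def)
  have val: "0 \<le> f (X i \<omega>) \<and> f (X i \<omega>) \<le> C * (2 * r)\<^sup>2"
    if "iid_uniform_ball M r n X" "i \<in> {1..n}" "\<omega> \<in> space M" for M :: "'a measure" and X n i \<omega>
    using sample(2)[OF that(1,2)] that(3) by (intro bounds) auto
  have indep: "prob_space.indep_vars M (\<lambda>_. borel) (\<lambda>i \<omega>. f (X i \<omega>)) {1..n}"
    if iid: "iid_uniform_ball M r n X" for M :: "'a measure" and X n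
  proof -
    interpret prob_space M using iid by (simp add: iid_uniform_ball_def)
    let ?g = "\<lambda>x. indicator (cball 0 r) x *\<^sub>R f x"
    have g: "?g \<in> borel_measurable borel"
      using cont by (intro borel_measurable_continuous_on_indicator) auto
    have "indep_vars (\<lambda>_. borel) X {1..n}" using iid by (simp add: iid_uniform_ball_def)
    from indep_vars_compose2[OF this, of "\<lambda>_. ?g" "\<lambda>_. borel"] g
    have "indep_vars (\<lambda>_. borel) (\<lambda>i \<omega>. ?g (X i \<omega>)) {1..n}" by simp
    then show ?thesis
    proof (rule indep_vars_cong_on_space)
      fix i \<omega> assume "i \<in> {1..n}" "\<omega> \<in> space M"
      then have "X i \<omega> \<in> cball 0 r" using sample(2)[OF iid] by blast
      then show "?g (X i \<omega>) = f (X i \<omega>)" by simp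
    qed
  qed
  have first: "c * r\<^sup>2 * 2 powr (- 2 / real ?d) / 2 * real n powr (- 2 / real ?d)
      \<le> prob_space.expectation M (\<lambda>\<omega>. f (ranked f n (\<lambda>i. X i \<omega>) 1))"
    if iid: "iid_uniform_ball M r n X" and n: "0 < n" for n and M :: "'a measure" and X
  proof -
    interpret prob_space M using iid by (simp add: iid_uniform_ball_def)
    \<comment> \<open>The threshold belongs to the radius \<open>r * q n\<close>, whose ball has
      \<open>1 / (2 * n)\<close> of the volume of the domain.\<close>
    have "c * (r * q n)\<^sup>2 / 2 \<le> expectation (\<lambda>\<omega>. f (ranked f n (\<lambda>i. X i \<omega>) 1))"
    proof (rule expectation_min_ge[where f = f and X = X, OF _ n val[OF iid]])
      show "random_variable borel (\<lambda>\<omega>. f (X i \<omega>))" if "i \<in> {1..n}" for i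
        using indep[OF iid] that by (auto simp: indep_vars_def)
      show "prob {\<omega>\<in>space M. f (X i \<omega>) < c * (r * q n)\<^sup>2} \<le> 1 / (2 * real n)" if i: "i \<in> {1..n}" for i
        using prob_sublevel_le[OF r sample(1-3)[OF iid i] cont c lower, of "r * q n"] r q0[of n] q_power[OF n]
        by simp
      show "0 \<le> c * (r * q n)\<^sup>2" using c by simp
    qed
    then show ?thesis by (simp add: power_mult_distrib q_sq[OF n] mult_ac)
  qed
  \<comment> \<open>The ball of radius \<open>b * sqrt h\<close> around \<open>a\<close> lies in the sublevel set of every attained value \<open>h > 0\<close>:
    the first term keeps it inside \<open>cball 0 r\<close>, the second keeps \<open>f < h\<close>.\<close>
  define b where "b = min ((r - norm a) / (2 * r * sqrt C)) (1 / sqrt (2 * C))"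
  have b: "0 < b" using a r C0 by (simp add: b_def)
  have b_sq: "C * b\<^sup>2 \<le> 1 / 2"
  proof -
    have "b\<^sup>2 \<le> (1 / sqrt (2 * C))\<^sup>2" using b by (intro power_mono) (auto simp: b_def)
    also have "\<dots> = 1 / (2 * C)" using C0 by (simp add: power_divide)
    finally show ?thesis using C0 by (simp add: field_simps)
  qed
  have second: "\<exists>\<psi>. cond_exp_version M (\<lambda>\<omega>. f (ranked f n (\<lambda>i. X i \<omega>) 1))
        (\<lambda>\<omega>. f (ranked f n (\<lambda>i. X i \<omega>) (Suc m))) \<psi> \<and> (\<forall>h. c * (b * q m)\<^sup>2 / 2 * h \<le> \<psi> h)"
    if iid: "iid_uniform_ball M r n X" and m: "0 < m" "m < n" for n m and M :: "'a measure" and X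
  proof -
    interpret prob_space M using iid by (simp add: iid_uniform_ball_def)
    show ?thesis
    \<comment> \<open>This \<open>p\<close> makes \<open>p * m\<close> exactly \<open>1 / 2\<close>;
      unification sets \<open>s\<close> to \<open>c * (b * q m)\<^sup>2\<close>.\<close>
    proof (rule cond_exp_order_statistics_ge[where f = f and X = X and n = n, OF indep[OF iid] m(2) val[OF iid], where p = "1 / (2 * real m)"])
      fix i j \<omega> assume i: "i \<in> {1..n}" and j: "j \<in> {1..n}" and \<omega>: "\<omega> \<in> space M"
      define h where "h = f (X j \<omega>)"
      have h: "0 \<le> h" "h \<le> C * (2 * r)\<^sup>2" using val[OF iid j \<omega>] by (auto simp: h_def)
      have "prob {\<omega>'\<in>space M. f (X i \<omega>') < c * (b * q m)\<^sup>2 * h} \<le> 1 / (2 * real m) * prob {\<omega>'\<in>space M. f (X i \<omega>') < h}"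
      \<comment> \<open>At \<open>h = 0\<close> no ball fits strictly below the level, but the left
        event is empty because \<open>f\<close> is nonnegative.\<close>
      proof (cases "h = 0")
        case True
        then have "{\<omega>'\<in>space M. f (X i \<omega>') < c * (b * q m)\<^sup>2 * h} = {}"
          using val[OF iid i] by (auto simp: not_less)
        then show ?thesis by (simp only: measure_empty) simp
      next
        case False
        with h have h0: "h > 0" by simp
        let ?\<rho> = "b * sqrt h"
        have "?\<rho> \<le> (r - norm a) / (2 * r * sqrt C) * sqrt (C * (2 * r)\<^sup>2)"
          using h a r C0 by (intro mult_mono) (auto simp: b_def)
        also have "\<dots> = r - norm a" using r C0 by (simp add: real_sqrt_mult)
        finally have \<rho>: "?\<rho> \<le> r - norm a" .
        have "C * ?\<rho>\<^sup>2 = (C * b\<^sup>2) * h" using h by (simp add: power_mult_distrib)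
        also have "\<dots> \<le> 1 / 2 * h" using b_sq h by (intro mult_right_mono) auto
        finally have \<rho>h: "C * ?\<rho>\<^sup>2 < h" using h0 by simp
        have eq: "c * (b * q m)\<^sup>2 * h = c * (?\<rho> * q m)\<^sup>2" using h by (simp add: power_mult_distrib)
        have "prob {\<omega>'\<in>space M. f (X i \<omega>') < c * (b * q m)\<^sup>2 * h} \<le> (?\<rho> * q m / r) ^ ?d"
          unfolding eq using b q0[of m] h0
          by (intro prob_sublevel_le[OF r sample(1-3)[OF iid i] cont c lower]) auto
        \<comment> \<open>The radius \<open>b * sqrt h\<close> enters both probability bounds, so
          their quotient is the power of \<open>q m\<close> alone, free of \<open>h\<close>.\<close>
        also have "\<dots> = 1 / (2 * real m) * (?\<rho> / r) ^ ?d"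
          using q_power[OF m(1)] by (simp add: power_mult_distrib power_divide)
        also have "\<dots> \<le> 1 / (2 * real m) * prob {\<omega>'\<in>space M. f (X i \<omega>') < h}"
          using prob_sublevel_ge[OF r sample(1-3)[OF iid i] cont C0 upper _ \<rho> \<rho>h] b h
          by (intro mult_left_mono) auto
        finally show ?thesis .
      qed
      then show "prob {\<omega>'\<in>space M. f (X i \<omega>') < c * (b * q m)\<^sup>2 * f (X j \<omega>)}
          \<le> 1 / (2 * real m) * prob {\<omega>'\<in>space M. f (X i \<omega>') < f (X j \<omega>)}"
        unfolding h_def .
    next
      have "c * (b * q m)\<^sup>2 \<le> C * (b * 1)\<^sup>2"
        using C C0 b q0[of m] q1[OF m(1)] by (intro mult_mono power_mono) auto
      with b_sq show "c * (b * q m)\<^sup>2 \<le> 1" by simp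
    qed (use c m in auto)
  qed
  define C2 where "C2 = c * b\<^sup>2 * 2 powr (- 2 / real ?d) / 2"
  have C2: "C2 > 0" using c b by (simp add: C2_def)
  have second': "\<exists>\<psi>. cond_exp_version M (\<lambda>\<omega>. f (ranked f n (\<lambda>i. X i \<omega>) 1))
        (\<lambda>\<omega>. f (ranked f n (\<lambda>i. X i \<omega>) (m + 1))) \<psi> \<and>
        (\<forall>h\<in>{0..SUP x\<in>cball 0 r. f x}. C2 * h * real m powr (- 2 / real ?d) \<le> \<psi> h)"
    if "iid_uniform_ball M r n X" "0 < m" "m < n" for n m and M :: "'a measure" and X
  proof -
    have eq: "c * (b * q m)\<^sup>2 / 2 * h = C2 * h * real m powr (- 2 / real ?d)" for h
      using q_sq[OF that(2)] by (simp add: C2_def power_mult_distrib mult_ac)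
    show ?thesis using second[OF that] unfolding eq Suc_eq_plus1 by blast
  qed
  show ?thesis
  proof (intro conjI allI impI)
    show "\<exists>C1>0. \<exists>lam1. \<forall>lam\<ge>lam1. \<forall>(M :: 'a measure) X. iid_uniform_ball M r lam X \<longrightarrow>
        prob_space.expectation M (\<lambda>\<omega>. f (ranked f lam (\<lambda>i. X i \<omega>) 1)) \<ge> C1 * real lam powr (- 2 / real ?d)"
      \<comment> \<open>The threshold \<open>1\<close> excludes the empty sample.\<close>
      using c r
      by (intro exI[of _ "c * r\<^sup>2 * 2 powr (- 2 / real ?d) / 2"] exI[of _ 1] conjI allI impI first) auto
  next
    fix \<mu> :: "nat \<Rightarrow> nat"
    assume \<mu>: "(\<forall>lam\<ge>2. 1 \<le> \<mu> lam \<and> \<mu> lam \<le> lam - 1) \<and> filterlim \<mu> at_top sequentially"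
    have "0 < \<mu> n \<and> \<mu> n < n" if "2 \<le> n" for n
      using \<mu> that by (auto dest!: spec[of _ n])
    with C2 show "\<exists>C2>0. \<exists>lam2. \<forall>lam\<ge>lam2. \<forall>(M :: 'a measure) X. iid_uniform_ball M r lam X \<longrightarrow>
           (\<exists>\<psi>. cond_exp_version M
                   (\<lambda>\<omega>. f (ranked f lam (\<lambda>i. X i \<omega>) 1))
                   (\<lambda>\<omega>. f (ranked f lam (\<lambda>i. X i \<omega>) (\<mu> lam + 1))) \<psi> \<and>
                (\<forall>h\<in>{0..SUP x\<in>cball 0 r. f x}.
                   \<psi> h \<ge> C2 * h * real (\<mu> lam) powr (- 2 / real ?d)))"
      by (intro exI[of _ C2] exI[of _ 2] conjI allI impI second') auto
  qed
qed

end
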